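(* $\mathfrak{x}_{\le,\le}=\mathfrak{x}_{\le,<}=\mathfrak{b}$.
   Context: $\mathbb{N}^{\mathbb{N}}$ is the set of functions $\mathbb{N}\to\mathbb{N}$; $f\le^* g$ means $f(n)\le g(n)$ for all but finitely many $n$. $\mathfrak{b}$ is the minimal size of a subset of $\mathbb{N}^{\mathbb{N}}$ unbounded with respect to $\le^*$. For $f,g\in\mathbb{N}^{\mathbb{N}}$ and a binary relation $R$ on $\mathbb{N}$, $[f R g]=\{n: f(n)Rg(n)\}$. For $R,S\in\{\le,<\}$, $X\subseteq\mathbb{N}^{\mathbb{N}}$ and $g\in\mathbb{N}^{\mathbb{N}}$, $g$ avoids middles in $X$ with respect to $\langle R,S\rangle$ if (1) for each $f\in X$ the set $[fRg]$ is infinite, and (2) for all $f,h\in X$ at least one of the sets $\{n: f(n)Rg(n)\text{ and }g(n)Sh(n)\}$ and $\{n: h(n)Rg(n)\text{ and }g(n)Sf(n)\}$ is finite. $X$ satisfies the excluded middle property with respect to $\langle R,S\rangle$ if some $g$ avoids middles in $X$ with respect to $\langle R,S\rangle$. $\mathfrak{x}_{R,S}$ is the minimal size of a subset of $\mathbb{N}^{\mathbb{N}}$ which does not satisfy the excluded middle property with respect to $\langle R,S\rangle$. *)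

theory Defs
  imports Main
begin

unbundle cardinal_syntax

text \<open>
  The minimal size of a set satisfying \<open>P\<close>, as a cardinal in the sense of the library
  (a well-order of minimal type). Sizes are compared by \<open>\<le>o\<close> and \<open>=o\<close>; the latter is
  equality of cardinals. The value is meaningful only if some set satisfies \<open>P\<close>,
  see \<open>min_size_attained\<close> and \<open>min_size_least\<close>.
\<close>

definition min_size :: "('a set \<Rightarrow> bool) \<Rightarrow> 'a rel" where
  "min_size P = |SOME X. P X \<and> (\<forall>Y. P Y \<longrightarrow> |X| \<le>o |Y| )|"

lemma min_size_ex:
  assumes "P X0"
  shows "\<exists>X. P X \<and> (\<forall>Y. P Y \<longrightarrow> |X| \<le>o |Y| )"
proof -
  have "\<exists>r \<in> card_of ` Collect P. \<forall>r' \<in> card_of ` Collect P. r \<le>o r'"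
    using assms by (intro exists_minim_Card_order) (auto intro: card_of_Card_order)
  then show ?thesis by auto
qed

lemma min_size_attained:
  assumes "P X0"
  shows "\<exists>X. P X \<and> min_size P = |X|"
  using someI_ex[OF min_size_ex[of P, OF assms]] unfolding min_size_def by blast

lemma min_size_least:
  assumes "P Y"
  shows "min_size P \<le>o |Y|"
  using someI_ex[OF min_size_ex[of P, OF assms]] assms unfolding min_size_def by blast

definition le_star :: "(nat \<Rightarrow> nat) \<Rightarrow> (nat \<Rightarrow> nat) \<Rightarrow> bool"  (infix \<open>\<le>\<^sup>*\<close> 50) where
  "f \<le>\<^sup>* g \<longleftrightarrow> (\<forall>\<^sub>\<infinity>n. f n \<le> g n)"

definition unbounded_star :: "(nat \<Rightarrow> nat) set \<Rightarrow> bool" where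
  "unbounded_star X \<longleftrightarrow> \<not> (\<exists>g. \<forall>f\<in>X. f \<le>\<^sup>* g)"

definition bounding_number :: "(nat \<Rightarrow> nat) rel"  (\<open>\<bb>\<close>) where
  "\<bb> = min_size unbounded_star"

definition avoids_middles ::
  "(nat \<Rightarrow> nat \<Rightarrow> bool) \<Rightarrow> (nat \<Rightarrow> nat \<Rightarrow> bool) \<Rightarrow> (nat \<Rightarrow> nat) \<Rightarrow> (nat \<Rightarrow> nat) set \<Rightarrow> bool" where
  "avoids_middles R S g X \<longleftrightarrow>
     (\<forall>f\<in>X. infinite {n. R (f n) (g n)}) \<and>
     (\<forall>f\<in>X. \<forall>h\<in>X. finite {n. R (f n) (g n) \<and> S (g n) (h n)} \<or>
                    finite {n. R (h n) (g n) \<and> S (g n) (f n)})"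

definition excluded_middle_property ::
  "(nat \<Rightarrow> nat \<Rightarrow> bool) \<Rightarrow> (nat \<Rightarrow> nat \<Rightarrow> bool) \<Rightarrow> (nat \<Rightarrow> nat) set \<Rightarrow> bool" where
  "excluded_middle_property R S X \<longleftrightarrow> (\<exists>g. avoids_middles R S g X)"

definition excluded_middle_number ::
  "(nat \<Rightarrow> nat \<Rightarrow> bool) \<Rightarrow> (nat \<Rightarrow> nat \<Rightarrow> bool) \<Rightarrow> (nat \<Rightarrow> nat) rel"  (\<open>\<xx>\<close>) where
  "\<xx> R S = min_size (\<lambda>X. \<not> excluded_middle_property R S X)"

text \<open>The whole of \<open>nat \<Rightarrow> nat\<close> witnesses that the minima in \<open>\<bb>\<close> and \<open>\<xx>\<close> are attained.\<close>

lemma unbounded_star_UNIV: "unbounded_star UNIV"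
proof -
  have "\<not> Suc \<circ> g \<le>\<^sup>* g" for g
    by (simp add: le_star_def)
  then show ?thesis unfolding unbounded_star_def by blast
qed

lemma not_excluded_middle_property_UNIV:
  assumes "R = (\<le>) \<or> R = (<)"
  shows "\<not> excluded_middle_property R S UNIV"
proof -
  have "finite {n. R ((Suc \<circ> g) n) (g n)}" for g
    using assms by auto
  then show ?thesis
    unfolding excluded_middle_property_def avoids_middles_def by blast
qed

end

(*
  If g bounds X, then Suc o g lies strictly above every member of X almost everywhere and
  hence avoids middles; so a set without the excluded middle property is unbounded.
  Conversely, copy each f of an unbounded X once onto the even and once onto the odd numbers,
  with value 0 elsewhere. If g avoids middles in the set of all these copies, then comparing
  an even copy of f with an odd copy of h shows that g bounds either all even copies or all odd
  copies, and so X is bounded. As X is infinite, the copies are no more numerous than X.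
*)
theory Submission
  imports Defs
begin

text \<open>By \<open>Q X0\<close> the minimum for \<open>Q\<close> is attained; the second
  assumption turns a minimal \<open>X\<close> into a witness for \<open>P\<close> that is no
  larger.\<close>

lemma min_size_mono:
  assumes "Q X0" and "\<And>X. Q X \<Longrightarrow> \<exists>Y. P Y \<and> |Y| \<le>o |X|"
  shows "min_size P \<le>o min_size Q"
proof -
  obtain X where X: "Q X" "min_size Q = |X|"
    using min_size_attained[of Q, OF assms(1)] by blast
  then obtain Y where "P Y" "|Y| \<le>o |X|"
    using assms(2) by blast
  then show ?thesis
    using min_size_least[of P Y] X ordLeq_transitive by metis
qed

text \<open>The pointwise sum is a bound. Hence unbounded sets are infinite, which
  \<open>card_of_copies\<close> needs to absorb the doubling.\<close>

lemma finite_not_unbounded_star: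
  assumes "finite X"
  shows "\<not> unbounded_star X"
proof -
  have "f \<le>\<^sup>* (\<lambda>n. \<Sum>h\<in>X. h n)" if "f \<in> X" for f
    unfolding le_star_def using assms that by (intro always_eventually allI member_le_sum) auto
  then show ?thesis
    unfolding unbounded_star_def by blast
qed

lemma excluded_middle_property_if_bounded:
  assumes "\<not> unbounded_star X"
  shows "excluded_middle_property (\<le>) (\<le>) X"
proof -
  obtain g where g: "f \<le>\<^sup>* g" if "f \<in> X" for f
    using assms unfolding unbounded_star_def by blast
  have above: "finite {n. \<not> f n \<le> g n}" if "f \<in> X" for f
    using g[OF that] by (simp add: le_star_def eventually_cofinite)
  have "infinite {n. f n \<le> Suc (g n)}" if "f \<in> X" for f
  proof -
    have "\<forall>\<^sub>\<infinity>n. f n \<le> Suc (g n)"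
      using g[OF that] unfolding le_star_def by (rule eventually_mono) simp
    then show ?thesis
      using eventually_frequently[of "cofinite :: nat filter"]
      by (simp add: frequently_cofinite)
  qed
  \<comment> \<open>The successor matters here: a middle forces \<open>g n < h n\<close>, which
    fails almost everywhere.\<close>
  moreover have "finite {n. f n \<le> Suc (g n) \<and> Suc (g n) \<le> h n}" if "h \<in> X" for f h
    by (rule finite_subset[OF _ above[OF that]]) auto
  ultimately show ?thesis
    unfolding excluded_middle_property_def avoids_middles_def
    by (intro exI[of _ "\<lambda>n. Suc (g n)"]) blast
qed

text \<open>A strict second relation only shrinks the middle sets, so the same \<open>g\<close>
  works.\<close>

lemma excluded_middle_property_le_less:
  assumes "excluded_middle_property (\<le>) (\<le>) X"
  shows "excluded_middle_property (\<le>) (<) X"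
proof -
  obtain g where g: "avoids_middles (\<le>) (\<le>) g X"
    using assms unfolding excluded_middle_property_def by blast
  have "finite {n. f n \<le> g n \<and> g n < h n}" if "finite {n. f n \<le> g n \<and> g n \<le> h n}"
    for f h :: "nat \<Rightarrow> nat"
    by (rule finite_subset[OF _ that]) auto
  then have "avoids_middles (\<le>) (<) g X"
    using g unfolding avoids_middles_def by blast
  then show ?thesis
    unfolding excluded_middle_property_def by blast
qed

text \<open>The default 0 makes \<open>\<le> g n\<close> automatic and \<open>g n <\<close>
  impossible off the support.\<close>

definition even_copy :: "(nat \<Rightarrow> nat) \<Rightarrow> nat \<Rightarrow> nat" where
  "even_copy f n = (if even n then f (n div 2) else 0)"

definition odd_copy :: "(nat \<Rightarrow> nat) \<Rightarrow> nat \<Rightarrow> nat" where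
  "odd_copy f n = (if even n then 0 else f (n div 2))"

lemma copies_not_excluded_middle_property:
  assumes "unbounded_star X"
  shows "\<not> excluded_middle_property (\<le>) (<) (even_copy ` X \<union> odd_copy ` X)"
proof
  assume "excluded_middle_property (\<le>) (<) (even_copy ` X \<union> odd_copy ` X)"
  then obtain g where g: "avoids_middles (\<le>) (<) g (even_copy ` X \<union> odd_copy ` X)"
    unfolding excluded_middle_property_def by blast
  have "f \<le>\<^sup>* (\<lambda>n. g (2 * n)) \<or> h \<le>\<^sup>* (\<lambda>n. g (2 * n + 1))" if "f \<in> X" "h \<in> X" for f h
  proof -
    have "finite {n. odd_copy h n \<le> g n \<and> g n < even_copy f n} \<or>
          finite {n. even_copy f n \<le> g n \<and> g n < odd_copy h n}"
      (is "finite ?A \<or> finite ?B")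
      using g that unfolding avoids_middles_def by blast
    then show ?thesis
    proof
      assume "finite ?A"
      \<comment> \<open>\<open>?A\<close> has only even elements; halving them gives the places
        where \<open>f\<close> exceeds the even part of \<open>g\<close>.\<close>
      then have "finite ((\<lambda>n. 2 * n) -` ?A)"
        by (rule finite_vimageI) (simp add: inj_on_def)
      moreover have "(\<lambda>n. 2 * n) -` ?A = {n. \<not> f n \<le> g (2 * n)}"
        by (auto simp: even_copy_def odd_copy_def)
      ultimately show ?thesis
        by (simp add: le_star_def eventually_cofinite)
    next
      assume "finite ?B"
      then have "finite ((\<lambda>n. 2 * n + 1) -` ?B)"
        by (rule finite_vimageI) (simp add: inj_on_def)
      moreover have "(\<lambda>n. 2 * n + 1) -` ?B = {n. \<not> h n \<le> g (2 * n + 1)}"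
        by (auto simp: even_copy_def odd_copy_def)
      ultimately show ?thesis
        by (simp add: le_star_def eventually_cofinite)
    qed
  qed
  \<comment> \<open>As \<open>f\<close> and \<open>h\<close> vary independently, one
    \<open>f\<close> not bounded by the even part of \<open>g\<close> forces every \<open>h\<close>
    below the odd part, up to finitely many places.\<close>
  then show False
    using assms unfolding unbounded_star_def by blast
qed

lemma card_of_copies:
  assumes "unbounded_star X"
  shows "|even_copy ` X \<union> odd_copy ` X| \<le>o |X|"
proof (rule card_of_Un_ordLeq_infinite_Field)
  show "infinite (Field |X| )"
    using assms finite_not_unbounded_star by (auto simp: Field_card_of)
qed (rule card_of_image card_of_Card_order)+

theorem theorem3p2:
  shows "\<xx> (\<le>) (\<le>) =o \<xx> (\<le>) (<) \<and> \<xx> (\<le>) (<) =o \<bb>"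
proof -
  have refl: "|X| \<le>o |X|" for X :: "(nat \<Rightarrow> nat) set"
    by (rule card_of_mono1) simp
  have not_UNIV: "\<not> excluded_middle_property (\<le>) S UNIV" for S
    by (rule not_excluded_middle_property_UNIV) simp
  \<comment> \<open>Three inequalities form a cycle. In the first two \<open>Y\<close> is
    \<open>X\<close> itself; only the third passes to copies.\<close>
  have "\<bb> \<le>o \<xx> (\<le>) (\<le>)"
    unfolding bounding_number_def excluded_middle_number_def
  proof (rule min_size_mono[of _ UNIV])
    show "\<exists>Y. unbounded_star Y \<and> |Y| \<le>o |X|"
      if "\<not> excluded_middle_property (\<le>) (\<le>) X" for X
      using that excluded_middle_property_if_bounded refl by metis
  qed (rule not_UNIV)
  moreover have "\<xx> (\<le>) (\<le>) \<le>o \<xx> (\<le>) (<)"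
    unfolding excluded_middle_number_def
  proof (rule min_size_mono[of _ UNIV])
    show "\<exists>Y. \<not> excluded_middle_property (\<le>) (\<le>) Y \<and> |Y| \<le>o |X|"
      if "\<not> excluded_middle_property (\<le>) (<) X" for X
      using that excluded_middle_property_le_less refl by metis
  qed (rule not_UNIV)
  moreover have "\<xx> (\<le>) (<) \<le>o \<bb>"
    unfolding bounding_number_def excluded_middle_number_def
  proof (rule min_size_mono[of _ UNIV])
    show "\<exists>Y. \<not> excluded_middle_property (\<le>) (<) Y \<and> |Y| \<le>o |X|"
      if "unbounded_star X" for X
      using copies_not_excluded_middle_property[OF that] card_of_copies[OF that] by blast
  qed (rule unbounded_star_UNIV)
  ultimately show ?thesis
    using ordIso_iff_ordLeq ordLeq_transitive by metis
qed

end
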